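(* Let $N\geq 1$ and let $q=(q_0,\ldots,q_{N-1})\in\mathbb T^N$. Define $$\Phi(q)=\sum_{\substack{i,j,k,l\in\{0,\ldots,N-1\}\\ i+k\equiv j+l \pmod N}}\frac{q_iq_k}{q_jq_l}.$$ Then $\Phi(q)\geq N^2$, with equality if and only if $\sqrt{N}\,q$ is the eigenvalue vector of a circulant complex Hadamard matrix $H\in M_N(\mathbb C)$, i.e. if and only if $H=\sqrt N\,FQF^*$ is a complex Hadamard matrix, where $Q=\mathrm{diag}(q_0,\ldots,q_{N-1})$ and $F=(w^{ij})_{i,j=0}^{N-1}/\sqrt N$ with $w=e^{2\pi{\rm i}/N}$.
   Context: $\mathbb T$ denotes the unit circle in $\mathbb C$. A complex Hadamard matrix is a square matrix whose entries all have modulus $1$ and whose rows are pairwise orthogonal. A matrix is circulant if $H_{ij}=\xi_{j-i}$ (indices mod $N$); circulant matrices are exactly those of the form $FQF^*$ with $Q$ diagonal, and then the diagonal of $Q$ is the vector of eigenvalues. *)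

theory Defs
  imports
    "Jordan_Normal_Form.Schur_Decomposition"
    "HOL-Number_Theory.Cong"
begin

definition Phi :: "nat \<Rightarrow> complex vec \<Rightarrow> complex" where
  "Phi N q = (\<Sum>(i, j, k, l) \<in> {(i, j, k, l). i < N \<and> j < N \<and> k < N \<and> l < N \<and> [i + k = j + l] (mod N)}.
     (q $ i * q $ k) / (q $ j * q $ l))"

definition fourier_mat :: "nat \<Rightarrow> complex mat" where
  "fourier_mat N =
     mat N N (\<lambda>(i, j). exp (2 * complex_of_real pi * \<i> / of_nat N) ^ (i * j) / complex_of_real (sqrt (real N)))"

definition complex_hadamard :: "nat \<Rightarrow> complex mat \<Rightarrow> bool" where
  "complex_hadamard N H \<longleftrightarrow> H \<in> carrier_mat N N \<and>
     (\<forall>i<N. \<forall>j<N. cmod (H $$ (i, j)) = 1) \<and>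
     (\<forall>i<N. \<forall>j<N. i \<noteq> j \<longrightarrow> row H i \<bullet>c row H j = 0)"

definition circulant :: "nat \<Rightarrow> complex mat \<Rightarrow> bool" where
  "circulant N H \<longleftrightarrow> H \<in> carrier_mat N N \<and>
     (\<exists>\<xi> :: int \<Rightarrow> complex. \<forall>i<N. \<forall>j<N. H $$ (i, j) = \<xi> ((int j - int i) mod int N))"

text \<open>The eigenvalues are listed in the order of the columns of the Fourier matrix, which are
  eigenvectors of every circulant matrix. For a square matrix \<open>H\<close> this means \<open>H = F Q F\<^sup>*\<close> with
  \<open>Q\<close> the diagonal matrix of \<open>v\<close>; see \<open>eigenvalue_vector_iff\<close> below.\<close>

definition eigenvalue_vector :: "nat \<Rightarrow> complex mat \<Rightarrow> complex vec \<Rightarrow> bool" where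
  "eigenvalue_vector N H v \<longleftrightarrow> v \<in> carrier_vec N \<and>
     (\<forall>j<N. eigenvector H (col (fourier_mat N) j) (v $ j))"

lemma fourier_mat_carrier [simp]: "fourier_mat N \<in> carrier_mat N N"
  by (simp add: fourier_mat_def)

lemma mat_adjoint_carrier: "A \<in> carrier_mat n m \<Longrightarrow> mat_adjoint A \<in> carrier_mat m n"
  by (rule carrier_matI) (simp_all add: mat_adjoint_def)

lemma mat_adjoint_index:
  assumes "i < dim_col A" "j < dim_row A"
  shows "mat_adjoint A $$ (i, j) = conjugate (A $$ (j, i))"
  using assms by (simp add: mat_adjoint_def mat_of_rows_index)

lemma fourier_mat_unitary: "mat_adjoint (fourier_mat N) * fourier_mat N = 1\<^sub>m N"
proof (rule eq_matI)
  let ?F = "fourier_mat N"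
  have Fd: "dim_row ?F = N" "dim_col ?F = N" by (simp_all add: fourier_mat_def)
  have ad: "mat_adjoint ?F \<in> carrier_mat N N" by (rule mat_adjoint_carrier) simp
  show "dim_row (mat_adjoint ?F * ?F) = dim_row (1\<^sub>m N)" "dim_col (mat_adjoint ?F * ?F) = dim_col (1\<^sub>m N)"
    using ad Fd by auto
  fix i j assume "i < dim_row (1\<^sub>m N :: complex mat)" "j < dim_col (1\<^sub>m N :: complex mat)"
  then have i: "i < N" and j: "j < N" by auto
  then have N: "N > 0" by simp
  define r where "r = cis (2 * pi * (real j - real i) / real N)"
  have "exp (2 * complex_of_real pi * \<i> / of_nat N) = cis (2 * pi / real N)"
    by (simp add: cis_conv_exp mult_ac)
  then have Fi: "?F $$ (a, b) = cis (2 * pi * real (a * b) / real N) / complex_of_real (sqrt N)"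
    if "a < N" "b < N" for a b
    using that by (simp add: fourier_mat_def DeMoivre mult_ac)
  have summand: "mat_adjoint ?F $$ (i, k) * ?F $$ (k, j) = r ^ k / of_nat N" if k: "k < N" for k
  proof -
    have "mat_adjoint ?F $$ (i, k) = cnj (?F $$ (k, i))"
      using i k Fd by (simp add: mat_adjoint_index)
    also have "\<dots> = cis (- (2 * pi * real (k * i) / real N)) / complex_of_real (sqrt N)"
      using Fi[OF k i] by (simp add: cis_cnj)
    finally have "mat_adjoint ?F $$ (i, k) * ?F $$ (k, j)
        = cis (- (2 * pi * real (k * i) / real N) + 2 * pi * real (k * j) / real N)
          / (complex_of_real (sqrt N) * complex_of_real (sqrt N))"
      using Fi[OF k j] by (simp add: cis_mult)
    also have "complex_of_real (sqrt N) * complex_of_real (sqrt N) = of_nat N"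
      by (simp flip: of_real_mult)
    also have "- (2 * pi * real (k * i) / real N) + 2 * pi * real (k * j) / real N
        = real k * (2 * pi * (real j - real i) / real N)"
      by (simp add: diff_divide_distrib algebra_simps)
    finally show ?thesis by (simp add: r_def DeMoivre)
  qed
  have "(mat_adjoint ?F * ?F) $$ (i, j) = (\<Sum>k<N. mat_adjoint ?F $$ (i, k) * ?F $$ (k, j))"
    using i j ad Fd by (auto simp: scalar_prod_def lessThan_atLeast0)
  also have "\<dots> = (\<Sum>k<N. r ^ k) / of_nat N"
    using summand by (simp add: sum_divide_distrib)
  also have "\<dots> = (if i = j then 1 else 0)"
  proof (cases "i = j")
    case True
    then show ?thesis using N by (simp add: r_def)
  next
    case False
    have rN: "r ^ N = 1"
    proof -
      have "r ^ N = cis (2 * pi * real_of_int (int j - int i))"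
        using N by (simp add: r_def DeMoivre)
      also have "\<dots> = 1" by (rule cis_multiple_2pi) simp
      finally show ?thesis .
    qed
    have "r \<noteq> 1"
    proof
      assume "r = 1"
      then have "cos (2 * pi * (real j - real i) / real N) = 1" by (simp add: r_def complex_eq_iff)
      then obtain m :: int where "2 * pi * (real j - real i) / real N = m * 2 * pi"
        by (auto simp: cos_one_2pi_int)
      then have "(2 * pi) * (real j - real i) = (2 * pi) * (m * real N)"
        using N by (simp add: divide_eq_eq mult_ac)
      then have "real j - real i = m * real N" by (subst (asm) mult_cancel_left) simp
      then have "real_of_int (int j - int i) = real_of_int (m * int N)" by simp
      then have m: "int j - int i = m * int N" by linarith
      then have "\<bar>m * int N\<bar> < int N" using i j by linarith
      then have "\<bar>m\<bar> * int N < 1 * int N" by (simp add: abs_mult)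
      then have "m = 0" using N by (simp only: mult_less_cancel_right) auto
      then show False using m False by simp
    qed
    then show ?thesis using rN False by (simp add: geometric_sum)
  qed
  finally show "(mat_adjoint ?F * ?F) $$ (i, j) = 1\<^sub>m N $$ (i, j)" using i j by simp
qed

lemma eigenvalue_vector_iff:
  assumes H: "H \<in> carrier_mat N N"
  shows "eigenvalue_vector N H v \<longleftrightarrow> v \<in> carrier_vec N \<and>
    H = fourier_mat N * mat_diag N (\<lambda>i. v $ i) * mat_adjoint (fourier_mat N)"
proof -
  let ?F = "fourier_mat N" and ?A = "mat_adjoint (fourier_mat N)" and ?D = "mat_diag N (\<lambda>i. v $ i)"
  have F: "?F \<in> carrier_mat N N" by simp
  have A: "?A \<in> carrier_mat N N" by (rule mat_adjoint_carrier[OF F])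
  have D: "?D \<in> carrier_mat N N" by simp
  have AF: "?A * ?F = 1\<^sub>m N" by (rule fourier_mat_unitary)
  have FA: "?F * ?A = 1\<^sub>m N" using mat_mult_left_right_inverse[OF A F AF] .
  have colF: "col ?F j \<noteq> 0\<^sub>v N" if j: "j < N" for j
  proof
    assume "col ?F j = 0\<^sub>v N"
    moreover have "(?A * ?F) $$ (j, j) = row ?A j \<bullet> col ?F j" using j A carrier_matD[OF F] by (intro index_mult_mat) auto
    ultimately have "(?A * ?F) $$ (j, j) = 0" using j A by (metis row_carrier_vec scalar_prod_right_zero)
    then show False using AF j by simp
  qed
  have "(\<forall>j<N. eigenvector H (col ?F j) (v $ j)) \<longleftrightarrow> H * ?F = ?F * ?D"
  proof -
    have c1: "col (H * ?F) j = H *\<^sub>v col ?F j" if "j < N" for j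
      using that F H by (metis carrier_matD(2) col_mult2)
    have c2: "col (?F * ?D) j = v $ j \<cdot>\<^sub>v col ?F j" if "j < N" for j
      unfolding mat_diag_mult_right[OF F]
      using that carrier_matD[OF F] by (intro eq_vecI) (auto simp: mult.commute)
    have "(\<forall>j<N. eigenvector H (col ?F j) (v $ j)) \<longleftrightarrow> (\<forall>j<N. col (H * ?F) j = col (?F * ?D) j)"
    proof (intro all_cong)
      fix j assume j: "j < N"
      show "eigenvector H (col ?F j) (v $ j) \<longleftrightarrow> col (H * ?F) j = col (?F * ?D) j"
        unfolding c1[OF j] c2[OF j] eigenvector_def
        using colF[OF j] carrier_matD[OF H] col_dim[of ?F j] carrier_matD[OF F] by metis
    qed
    also have "\<dots> \<longleftrightarrow> H * ?F = ?F * ?D"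
    proof
      assume eq: "\<forall>j<N. col (H * ?F) j = col (?F * ?D) j"
      have "dim_row (H * ?F) = N" "dim_col (H * ?F) = N" "dim_row (?F * ?D) = N" "dim_col (?F * ?D) = N"
        using carrier_matD[OF H] carrier_matD[OF F] carrier_matD[OF D] by simp_all
      then show "H * ?F = ?F * ?D" using eq by (intro mat_col_eqI) simp_all
    qed simp
    finally show ?thesis .
  qed
  also have "\<dots> \<longleftrightarrow> H = ?F * ?D * ?A"
  proof
    assume "H * ?F = ?F * ?D"
    then have "?F * ?D * ?A = H * ?F * ?A" by simp
    also have "\<dots> = H * (?F * ?A)" by (rule assoc_mult_mat[OF H F A])
    finally show "H = ?F * ?D * ?A" using FA H by simp
  next
    assume "H = ?F * ?D * ?A"
    then have "H * ?F = ?F * ?D * ?A * ?F" by simp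
    also have "\<dots> = ?F * ?D * (?A * ?F)" by (rule assoc_mult_mat[OF mult_carrier_mat[OF F D] A F])
    also have "\<dots> = ?F * ?D"
      unfolding AF by (rule right_mult_one_mat[OF mult_carrier_mat[OF F D]])
    finally show "H * ?F = ?F * ?D" .
  qed
  finally show ?thesis by (simp add: eigenvalue_vector_def)
qed

end

theory Submission
  imports Defs
begin

text \<open>Up to the factor \<open>1/\<surd>N\<close>, the first row of \<open>\<surd>N F Q F\<^sup>*\<close> is the Fourier transform \<open>g\<close> of \<open>q\<close>.
  Orthogonality of characters gives \<open>\<Sum>|g|\<^sup>2 = N\<^sup>2\<close> and \<open>\<Sum>|g|\<^sup>4 = N \<Phi>(q)\<close>, hence
  \<open>\<Sum>(|g|\<^sup>2 - N)\<^sup>2 = N (\<Phi>(q) - N\<^sup>2)\<close>. So \<open>\<Phi>(q) \<ge> N\<^sup>2\<close>, with equality iff all entries of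
  \<open>\<surd>N F Q F\<^sup>*\<close> have modulus 1; its rows are always orthogonal, because \<open>Q\<close> is unitary.\<close>

section \<open>Characters of Z/N and the Fourier transform\<close>

text \<open>The power \<open>w^x\<close> of the root of unity \<open>w\<close>. Integer exponents
  allow differences of indices and negative values without prior reduction mod N.\<close>

definition add_char :: "nat \<Rightarrow> int \<Rightarrow> complex" where
  "add_char N x = cis (2 * pi * of_int x / real N)"

text \<open>Unnormalised, with the minus sign that matches column minus row in the entries of
  \<open>F Q F\<^sup>*\<close>; the argument is an integer so that such differences can be inserted
  directly.\<close>

definition dft :: "nat \<Rightarrow> complex vec \<Rightarrow> int \<Rightarrow> complex" where
  "dft N q m = (\<Sum>k<N. q $ k * add_char N (- (int k * m)))"

lemma add_char_add: "add_char N (x + y) = add_char N x * add_char N y"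
  by (simp add: add_char_def cis_mult add_divide_distrib distrib_left)

lemma cnj_add_char: "cnj (add_char N x) = add_char N (- x)"
  by (simp add: add_char_def cis_cnj)

lemma add_char_power: "add_char N x ^ n = add_char N (int n * x)"
  by (simp add: add_char_def DeMoivre mult_ac)

lemma add_char_eq_1_iff:
  assumes "N > 0"
  shows "add_char N x = 1 \<longleftrightarrow> int N dvd x"
proof
  assume "add_char N x = 1"
  then have "cos (2 * pi * of_int x / real N) = 1"
    by (simp add: add_char_def complex_eq_iff)
  then obtain m :: int where "2 * pi * of_int x / real N = m * 2 * pi"
    by (auto simp: cos_one_2pi_int)
  then have "(2 * pi) * of_int x = (2 * pi) * (m * real N)"
    using assms by (simp add: divide_eq_eq mult_ac)
  then have "of_int x = m * real N"
    by (subst (asm) mult_cancel_left) simp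
  then have "real_of_int x = real_of_int (m * int N)" by simp
  then have "x = m * int N" by linarith
  then show "int N dvd x" by simp
next
  assume "int N dvd x"
  then obtain m where x: "x = int N * m" by blast
  have "2 * pi * of_int x / real N = 2 * pi * of_int m"
    using assms by (simp add: x)
  then show "add_char N x = 1"
    unfolding add_char_def by (simp add: cis_multiple_2pi)
qed

text \<open>A geometric series whose ratio \<open>add_char N x\<close> is an N-th root of unity: it
  vanishes unless the ratio is 1.\<close>

lemma sum_add_char:
  assumes "N > 0"
  shows "(\<Sum>a<N. add_char N (int a * x)) = (if int N dvd x then of_nat N else 0)"
proof (cases "int N dvd x")
  case True
  then have "add_char N (int a * x) = 1" for a
    using assms by (simp add: add_char_eq_1_iff)
  then show ?thesis using True by simp
next
  case False
  have "add_char N x ^ N = 1"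
    using assms by (simp add: add_char_power add_char_eq_1_iff)
  moreover have "add_char N x \<noteq> 1"
    using assms False by (simp add: add_char_eq_1_iff)
  ultimately have "(\<Sum>a<N. add_char N x ^ a) = 0"
    by (simp add: geometric_sum)
  then show ?thesis using False by (simp add: add_char_power)
qed

text \<open>Reducing \<open>m\<close> shifts each exponent by a multiple of N. This periodicity is
  what makes the matrix below circulant.\<close>

lemma dft_mod:
  assumes "N > 0"
  shows "dft N q (m mod int N) = dft N q m"
  unfolding dft_def
proof (rule sum.cong[OF refl])
  fix k
  have "- (int k * (m mod int N)) = - (int k * m) + int k * (m - m mod int N)"
    by (simp add: algebra_simps)
  moreover have "add_char N (int k * (m - m mod int N)) = 1"
    using assms by (simp add: add_char_eq_1_iff)
  ultimately show "q $ k * add_char N (- (int k * (m mod int N))) = q $ k * add_char N (- (int k * m))"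
    by (simp only: add_char_add mult_1_right)
qed

lemma dvd_int_diff_less_iff:
  assumes "i < N" "j < N"
  shows "int N dvd int i - int j \<longleftrightarrow> i = j"
  using assms by (simp flip: cong_iff_dvd_diff add: cong_int_iff cong_def)

section \<open>Second and fourth moments of the Fourier transform\<close>

text \<open>Used twice: \<open>x = y = 0\<close> is Parseval's identity, and \<open>x = i\<close>,
  \<open>y = j\<close> gives orthogonality of rows \<open>i\<close> and \<open>j\<close>.\<close>

lemma dft_correlation:
  assumes "N > 0" and q: "\<And>k. k < N \<Longrightarrow> cmod (q $ k) = 1"
  shows "(\<Sum>b<N. dft N q (int b - x) * cnj (dft N q (int b - y))) =
    (if int N dvd x - y then (of_nat N)\<^sup>2 else 0)"
proof -
  have "(\<Sum>b<N. dft N q (int b - x) * cnj (dft N q (int b - y))) =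
    (\<Sum>b<N. \<Sum>k<N. \<Sum>l<N. q $ k * cnj (q $ l) * add_char N (int k * x - int l * y)
       * add_char N (int b * (int l - int k)))"
    unfolding dft_def cnj_sum sum_product
    by (intro sum.cong refl)
      (simp add: cnj_add_char algebra_simps flip: add_char_add)
  also have "\<dots> = (\<Sum>k<N. \<Sum>l<N. \<Sum>b<N. q $ k * cnj (q $ l) * add_char N (int k * x - int l * y)
       * add_char N (int b * (int l - int k)))"
    by (subst sum.swap, rule sum.cong[OF refl], rule sum.swap)
  \<comment> \<open>The sum over \<open>b\<close> is a full character sum, so only
    \<open>k = l\<close> survives, where the coefficient is \<open>|q_k|^2 = 1\<close>.\<close>
  also have "\<dots> = (\<Sum>k<N. \<Sum>l<N. if l = k then of_nat N * add_char N (int k * (x - y)) else 0)"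
  proof (intro sum.cong refl)
    fix k l assume "k \<in> {..<N}" "l \<in> {..<N}"
    then have kl: "k < N" "l < N" by auto
    have "q $ k * cnj (q $ k) = 1"
      using q[OF kl(1)] by (simp add: complex_norm_square[symmetric])
    then show "(\<Sum>b<N. q $ k * cnj (q $ l) * add_char N (int k * x - int l * y)
       * add_char N (int b * (int l - int k))) =
      (if l = k then of_nat N * add_char N (int k * (x - y)) else 0)"
      using kl assms(1)
      by (simp only: sum_distrib_left[symmetric] sum_add_char dvd_int_diff_less_iff)
        (simp add: right_diff_distrib)
  qed
  also have "\<dots> = of_nat N * (\<Sum>k<N. add_char N (int k * (x - y)))"
    by (simp add: sum_distrib_left)
  finally show ?thesis
    using assms(1) by (simp add: sum_add_char power2_eq_square)
qed

text \<open>On the unit circle the inverse is the conjugate. With the congruence as an indicator,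
  the sum takes the shape in which \<open>|g|^4\<close> expands.\<close>

lemma Phi_eq_sum:
  assumes q: "\<And>i. i < N \<Longrightarrow> cmod (q $ i) = 1"
  shows "Phi N q = (\<Sum>i<N. \<Sum>j<N. \<Sum>k<N. \<Sum>l<N.
    if [i + k = j + l] (mod N) then q $ i * cnj (q $ j) * (q $ k * cnj (q $ l)) else 0)"
proof -
  let ?A = "{..<N} \<times> {..<N} \<times> {..<N} \<times> {..<N}"
  have inv: "1 / q $ i = cnj (q $ i)" if "i < N" for i
  proof -
    have "q $ i * cnj (q $ i) = 1"
      using q[OF that] by (simp add: complex_norm_square[symmetric])
    then show ?thesis
      by (simp add: divide_inverse inverse_unique)
  qed
  have "Phi N q = (\<Sum>(i, j, k, l) \<in> {x \<in> ?A. case x of (i, j, k, l) \<Rightarrow> [i + k = j + l] (mod N)}.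
     (q $ i * q $ k) / (q $ j * q $ l))"
    unfolding Phi_def by (rule sum.cong) auto
  also have "\<dots> = (\<Sum>(i, j, k, l) \<in> {x \<in> ?A. case x of (i, j, k, l) \<Rightarrow> [i + k = j + l] (mod N)}.
     q $ i * cnj (q $ j) * (q $ k * cnj (q $ l)))"
    by (rule sum.cong) (auto simp: inv[symmetric])
  also have "\<dots> = (\<Sum>(i, j, k, l) \<in> ?A.
    if [i + k = j + l] (mod N) then q $ i * cnj (q $ j) * (q $ k * cnj (q $ l)) else 0)"
    by (subst sum.inter_filter) (auto intro!: sum.cong)
  also have "\<dots> = (\<Sum>i<N. \<Sum>j<N. \<Sum>k<N. \<Sum>l<N.
    if [i + k = j + l] (mod N) then q $ i * cnj (q $ j) * (q $ k * cnj (q $ l)) else 0)"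
    by (simp add: sum.cartesian_product)
  finally show ?thesis .
qed

text \<open>Each \<open>|g(a)|^4\<close> is a product of two copies of the double sum for
  \<open>|g(a)|^2\<close>. Summing over \<open>a\<close>, orthogonality of characters selects
  exactly the index tuples of \<open>Phi\<close>.\<close>

lemma sum_dft_fourth_power:
  assumes "N > 0" and q: "\<And>i. i < N \<Longrightarrow> cmod (q $ i) = 1"
  shows "(\<Sum>a<N. complex_of_real (cmod (dft N q (int a)) ^ 4)) = of_nat N * Phi N q"
proof -
  let ?c = "\<lambda>i j k l. q $ i * cnj (q $ j) * (q $ k * cnj (q $ l))"
  let ?m = "\<lambda>i j k l. int (j + l) - int (i + k)"
  have "complex_of_real (cmod (dft N q (int a)) ^ 4) =
    (\<Sum>i<N. \<Sum>j<N. \<Sum>k<N. \<Sum>l<N. ?c i j k l * add_char N (int a * ?m i j k l))" for a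
  proof -
    let ?t = "\<lambda>i j. q $ i * cnj (q $ j) * add_char N (int a * (int j - int i))"
    have "complex_of_real ((cmod (dft N q (int a)))\<^sup>2) = (\<Sum>i<N. \<Sum>j<N. ?t i j)"
      unfolding complex_norm_square dft_def cnj_sum sum_product
      by (intro sum.cong refl) (simp add: cnj_add_char algebra_simps flip: add_char_add)
    moreover have "complex_of_real (cmod (dft N q (int a)) ^ 4) =
      complex_of_real ((cmod (dft N q (int a)))\<^sup>2) * complex_of_real ((cmod (dft N q (int a)))\<^sup>2)"
      by (simp flip: of_real_mult power_add)
    ultimately have "complex_of_real (cmod (dft N q (int a)) ^ 4) =
      (\<Sum>i<N. \<Sum>j<N. ?t i j) * (\<Sum>k<N. \<Sum>l<N. ?t k l)" by simp
    also have "\<dots> = (\<Sum>i<N. \<Sum>j<N. \<Sum>k<N. \<Sum>l<N. ?t i j * ?t k l)"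
      unfolding sum_distrib_right unfolding sum_distrib_left ..
    also have "\<dots> = (\<Sum>i<N. \<Sum>j<N. \<Sum>k<N. \<Sum>l<N. ?c i j k l * add_char N (int a * ?m i j k l))"
    proof (intro sum.cong refl)
      fix i j k l
      have "int a * ?m i j k l = int a * (int j - int i) + int a * (int l - int k)"
        by (simp add: algebra_simps)
      then show "?t i j * ?t k l = ?c i j k l * add_char N (int a * ?m i j k l)"
        by (simp only: add_char_add mult_ac)
    qed
    finally show ?thesis .
  qed
  then have "(\<Sum>a<N. complex_of_real (cmod (dft N q (int a)) ^ 4)) =
    (\<Sum>a<N. \<Sum>i<N. \<Sum>j<N. \<Sum>k<N. \<Sum>l<N. ?c i j k l * add_char N (int a * ?m i j k l))"
    by simp
  also have "\<dots> = (\<Sum>i<N. \<Sum>j<N. \<Sum>k<N. \<Sum>l<N. \<Sum>a<N. ?c i j k l * add_char N (int a * ?m i j k l))"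
    by (subst sum.swap, rule sum.cong[OF refl], subst sum.swap, rule sum.cong[OF refl],
        subst sum.swap, rule sum.cong[OF refl], rule sum.swap)
  also have "\<dots> = (\<Sum>i<N. \<Sum>j<N. \<Sum>k<N. \<Sum>l<N. of_nat N *
    (if [i + k = j + l] (mod N) then ?c i j k l else 0))"
  proof (intro sum.cong refl)
    fix i j k l
    \<comment> \<open>The sides are exchanged because the minus sign in \<open>dft\<close> puts
      \<open>j\<close> and \<open>l\<close> positively into the exponent.\<close>
    have "[i + k = j + l] (mod N) \<longleftrightarrow> [j + l = i + k] (mod N)"
      by (rule cong_sym_eq)
    also have "\<dots> \<longleftrightarrow> int N dvd ?m i j k l"
      by (simp only: cong_int_iff[symmetric] cong_iff_dvd_diff)
    finally show "(\<Sum>a<N. ?c i j k l * add_char N (int a * ?m i j k l)) =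
      of_nat N * (if [i + k = j + l] (mod N) then ?c i j k l else 0)"
      using assms(1) by (simp add: sum_add_char flip: sum_distrib_left del: of_nat_add)
  qed
  also have "\<dots> = of_nat N * Phi N q"
    using q by (simp add: Phi_eq_sum sum_distrib_left)
  finally show ?thesis .
qed

lemma sum_dft_deviation:
  assumes "N > 0" and q: "\<And>i. i < N \<Longrightarrow> cmod (q $ i) = 1"
  shows "of_nat N * (Phi N q - (of_nat N)\<^sup>2) =
    complex_of_real (\<Sum>a<N. ((cmod (dft N q (int a)))\<^sup>2 - real N)\<^sup>2)"
proof -
  let ?g = "\<lambda>a. cmod (dft N q (int a))"
  have "complex_of_real (\<Sum>a<N. (?g a)\<^sup>2) = complex_of_real ((real N)\<^sup>2)"
    \<comment> \<open>Parseval: the second moment is N^2, as all \<open>q_k\<close> have modulus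
      1.\<close>
    using dft_correlation[OF assms, where x = 0 and y = 0]
    by (simp add: of_real_sum complex_norm_square del: of_real_power) simp
  then have "(\<Sum>a<N. (?g a)\<^sup>2) = (real N)\<^sup>2"
    by (simp only: of_real_eq_iff)
  moreover have "((?g a)\<^sup>2 - real N)\<^sup>2 = ?g a ^ 4 - 2 * real N * (?g a)\<^sup>2 + (real N)\<^sup>2" for a
    by (simp add: power2_eq_square power4_eq_xxxx algebra_simps)
  \<comment> \<open>The last two terms of the expansion sum to -2 N^3 + N^3.\<close>
  ultimately have "(\<Sum>a<N. ((?g a)\<^sup>2 - real N)\<^sup>2) = (\<Sum>a<N. ?g a ^ 4) - real N * (real N)\<^sup>2"
    by (simp only: sum.distrib sum_subtractf sum_distrib_left[symmetric]) simp
  moreover have "complex_of_real (\<Sum>a<N. ?g a ^ 4) = of_nat N * Phi N q"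
    using sum_dft_fourth_power[OF assms] by simp
  ultimately show ?thesis
    by (simp only: of_real_diff) (simp add: right_diff_distrib)
qed

section \<open>The circulant matrix attached to \<open>q\<close>\<close>

lemma fourier_mat_index:
  assumes "i < N" "j < N"
  shows "fourier_mat N $$ (i, j) = add_char N (int i * int j) / complex_of_real (sqrt (real N))"
proof -
  have "exp (2 * complex_of_real pi * \<i> / of_nat N) = cis (2 * pi / real N)"
    by (simp add: cis_conv_exp mult_ac)
  then show ?thesis
    using assms by (simp add: fourier_mat_def add_char_def DeMoivre mult_ac)
qed

abbreviation (input) circ_of :: "nat \<Rightarrow> complex vec \<Rightarrow> complex mat" where
  "circ_of N q \<equiv> complex_of_real (sqrt (real N)) \<cdot>\<^sub>m
    (fourier_mat N * mat_diag N (\<lambda>i. q $ i) * mat_adjoint (fourier_mat N))"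

lemma circ_of_carrier: "circ_of N q \<in> carrier_mat N N"
  by (intro smult_carrier_mat mult_carrier_mat[of _ N N] mat_adjoint_carrier) auto

text \<open>\<open>F\<close> and its adjoint each contribute a factor 1/sqrt(N), one of which the
  prefactor cancels; their characters combine to exponent \<open>-k(b - a)\<close>.\<close>

lemma circ_of_index:
  assumes "a < N" "b < N"
  shows "circ_of N q $$ (a, b) = dft N q (int b - int a) / complex_of_real (sqrt (real N))"
proof -
  let ?F = "fourier_mat N" and ?s = "complex_of_real (sqrt (real N))"
  have F: "?F \<in> carrier_mat N N" by simp
  have A: "mat_adjoint ?F \<in> carrier_mat N N" by (rule mat_adjoint_carrier[OF F])
  have s0: "?s \<noteq> 0" using assms by simp
  have "circ_of N q $$ (a, b) = ?s * (\<Sum>k<N. ?F $$ (a, k) * q $ k * mat_adjoint ?F $$ (k, b))"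
    unfolding mat_diag_mult_right[OF F]
    using assms carrier_matD[OF A] by (simp add: scalar_prod_def lessThan_atLeast0)
  also have "\<dots> = ?s * (\<Sum>k<N. q $ k * add_char N (- (int k * (int b - int a))) / (?s * ?s))"
  proof (rule arg_cong[where f = "\<lambda>x. ?s * x"], rule sum.cong[OF refl])
    fix k assume "k \<in> {..<N}"
    then have k: "k < N" by simp
    have "mat_adjoint ?F $$ (k, b) = add_char N (- (int b * int k)) / ?s"
      using k assms carrier_matD[OF F] by (simp add: mat_adjoint_index fourier_mat_index cnj_add_char)
    moreover have "- (int k * (int b - int a)) = int a * int k + - (int b * int k)"
      by (simp add: algebra_simps)
    ultimately show "?F $$ (a, k) * q $ k * mat_adjoint ?F $$ (k, b) =
      q $ k * add_char N (- (int k * (int b - int a))) / (?s * ?s)"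
      using assms k by (simp only: add_char_add fourier_mat_index) simp
  qed
  also have "\<dots> = dft N q (int b - int a) / ?s"
    using s0 by (simp add: dft_def flip: sum_divide_distrib)
  finally show ?thesis .
qed

lemma circulant_circ_of:
  assumes "N > 0"
  shows "circulant N (circ_of N q)"
  unfolding circulant_def
proof (intro conjI exI allI impI)
  show "circ_of N q \<in> carrier_mat N N" by (rule circ_of_carrier)
  fix i j assume "i < N" "j < N"
  \<comment> \<open>The abstraction over \<open>m\<close> is the witness for \<xi>.\<close>
  then show "circ_of N q $$ (i, j) =
    (\<lambda>m. dft N q m / complex_of_real (sqrt (real N))) ((int j - int i) mod int N)"
    using assms by (simp only: circ_of_index dft_mod)
qed

text \<open>The rows are cyclic translates of \<open>g\<close>, and distinct translates are
  uncorrelated because \<open>Q\<close> is unitary.\<close>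

lemma circ_of_rows_orthogonal:
  assumes "N > 0" and q: "\<And>i. i < N \<Longrightarrow> cmod (q $ i) = 1"
    and ij: "i < N" "j < N" "i \<noteq> j"
  shows "row (circ_of N q) i \<bullet>c row (circ_of N q) j = 0"
proof -
  let ?s = "complex_of_real (sqrt (real N))"
  have d: "dim_row (circ_of N q) = N" "dim_col (circ_of N q) = N"
    using circ_of_carrier[of N q] by (simp_all only: carrier_matD)
  have "row (circ_of N q) i \<bullet>c row (circ_of N q) j =
    (\<Sum>b<N. circ_of N q $$ (i, b) * cnj (circ_of N q $$ (j, b)))"
    \<comment> \<open>Entries stay unexpanded so that the closed form \<open>circ_of_index\<close>
      can replace them next.\<close>
    using ij d by (simp add: scalar_prod_def lessThan_atLeast0 del: index_smult_mat index_mult_mat)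
  also have "\<dots> = (\<Sum>b<N. dft N q (int b - int i) * cnj (dft N q (int b - int j)) / (?s * ?s))"
    using ij by (intro sum.cong refl) (simp add: circ_of_index del: index_smult_mat index_mult_mat)
  also have "\<dots> = 0"
    using ij by (simp only: sum_divide_distrib[symmetric] dft_correlation[OF assms(1,2)])
      (simp add: dvd_int_diff_less_iff)
  finally show ?thesis .
qed

text \<open>Orthogonality of the rows is automatic, so only the moduli of the entries matter, and
  these are the values of \<open>|g|\<close> divided by sqrt(N).\<close>

lemma complex_hadamard_circ_of_iff:
  assumes "N > 0" and q: "\<And>i. i < N \<Longrightarrow> cmod (q $ i) = 1"
  shows "complex_hadamard N (circ_of N q) \<longleftrightarrow> (\<forall>a<N. (cmod (dft N q (int a)))\<^sup>2 = real N)"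
proof -
  have entry: "cmod (circ_of N q $$ (i, j)) = 1 \<longleftrightarrow>
    (cmod (dft N q ((int j - int i) mod int N)))\<^sup>2 = real N" if "i < N" "j < N" for i j
  proof -
    have "cmod (circ_of N q $$ (i, j)) = cmod (dft N q (int j - int i)) / sqrt (real N)"
      by (simp only: circ_of_index[OF that] norm_divide norm_of_real) simp
    also have "\<dots> = 1 \<longleftrightarrow> cmod (dft N q (int j - int i)) = sqrt (real N)"
      using assms(1) by (auto simp: divide_eq_1_iff)
    also have "\<dots> \<longleftrightarrow> (cmod (dft N q (int j - int i)))\<^sup>2 = real N"
      by (auto intro!: real_sqrt_unique[symmetric])
    finally show ?thesis by (simp only: dft_mod[OF assms(1)])
  qed
  have "complex_hadamard N (circ_of N q) \<longleftrightarrow>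
    (\<forall>i<N. \<forall>j<N. cmod (circ_of N q $$ (i, j)) = 1)"
    unfolding complex_hadamard_def
    using circ_of_carrier circ_of_rows_orthogonal[OF assms] by blast
  also have "\<dots> \<longleftrightarrow> (\<forall>a<N. (cmod (dft N q (int a)))\<^sup>2 = real N)"
  proof (intro iffI allI impI)
    fix a assume "\<forall>i<N. \<forall>j<N. cmod (circ_of N q $$ (i, j)) = 1" "a < N"
    then show "(cmod (dft N q (int a)))\<^sup>2 = real N"
      \<comment> \<open>Row 0 already contains every value \<open>g(a)\<close>.\<close>
      using entry[of 0 a] assms(1) by simp
  next
    fix i j assume *: "\<forall>a<N. (cmod (dft N q (int a)))\<^sup>2 = real N" and ij: "i < N" "j < N"
    define a where "a = nat ((int j - int i) mod int N)"
    have "a < N" "int a = (int j - int i) mod int N"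
      using assms(1) by (simp_all add: a_def nat_less_iff)
    then show "cmod (circ_of N q $$ (i, j)) = 1"
      using * ij by (metis entry)
  qed
  finally show ?thesis .
qed

text \<open>The scalar sqrt(N) moves from the diagonal to the whole product. Prescribing the
  eigenvalues thus determines the matrix, so the existential in the theorem concerns a single
  candidate.\<close>

lemma eigenvalue_vector_circ_of_iff:
  assumes H: "H \<in> carrier_mat N N" and q: "q \<in> carrier_vec N"
  shows "eigenvalue_vector N H (complex_of_real (sqrt (real N)) \<cdot>\<^sub>v q) \<longleftrightarrow> H = circ_of N q"
proof -
  let ?F = "fourier_mat N" and ?s = "complex_of_real (sqrt (real N))"
  have F: "?F \<in> carrier_mat N N" by simp
  have D: "mat_diag N (\<lambda>i. q $ i) \<in> carrier_mat N N" by simp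
  have "mat_diag N (\<lambda>i. (?s \<cdot>\<^sub>v q) $ i) = ?s \<cdot>\<^sub>m mat_diag N (\<lambda>i. q $ i)"
    using q by (intro eq_matI) (auto simp: mat_diag_def)
  then have "?F * mat_diag N (\<lambda>i. (?s \<cdot>\<^sub>v q) $ i) * mat_adjoint ?F = circ_of N q"
    by (simp only: mult_smult_distrib[OF F D]
        mult_smult_assoc_mat[OF mult_carrier_mat[OF F D] mat_adjoint_carrier[OF F]])
  then show ?thesis
    unfolding eigenvalue_vector_iff[OF H] using q by simp
qed

section \<open>The inequality and its equality case\<close>

theorem theorem3p5:
  fixes N :: nat and q :: "complex vec"
  assumes "N \<ge> 1"
    and "q \<in> carrier_vec N"
    and "\<And>i. i < N \<Longrightarrow> cmod (q $ i) = 1"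
  shows "Phi N q \<in> \<real> \<and> Re (Phi N q) \<ge> (real N)\<^sup>2 \<and>
    (Phi N q = (of_nat N)\<^sup>2 \<longleftrightarrow>
       (\<exists>H. circulant N H \<and> complex_hadamard N H \<and>
            eigenvalue_vector N H (complex_of_real (sqrt (real N)) \<cdot>\<^sub>v q))) \<and>
    (Phi N q = (of_nat N)\<^sup>2 \<longleftrightarrow>
       complex_hadamard N (complex_of_real (sqrt (real N)) \<cdot>\<^sub>m
         (fourier_mat N * mat_diag N (\<lambda>i. q $ i) * mat_adjoint (fourier_mat N))))"
proof -
  have N: "N > 0" using assms(1) by simp
  define S where "S = (\<Sum>a<N. ((cmod (dft N q (int a)))\<^sup>2 - real N)\<^sup>2)"
  have "of_nat N * (Phi N q - (of_nat N)\<^sup>2) = complex_of_real S"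
    unfolding S_def using N assms(3) by (rule sum_dft_deviation)
  then have "Phi N q - (of_nat N)\<^sup>2 = complex_of_real S / of_nat N"
    using N by (simp add: nonzero_eq_divide_eq mult.commute)
  \<comment> \<open>This form shows at once that \<open>Phi N q\<close> is real and, since
    \<open>S\<close> is nonnegative, that it is at least N^2.\<close>
  then have Phi: "Phi N q = complex_of_real ((real N)\<^sup>2 + S / real N)"
    by (simp add: algebra_simps)
  have S0: "S \<ge> 0" unfolding S_def by (intro sum_nonneg) simp
  have "Phi N q = (of_nat N)\<^sup>2 \<longleftrightarrow> complex_of_real ((real N)\<^sup>2 + S / real N) = complex_of_real ((real N)\<^sup>2)"
    by (simp only: Phi) simp
  also have "\<dots> \<longleftrightarrow> S = 0"
    unfolding of_real_eq_iff using N by simp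
  also have "\<dots> \<longleftrightarrow> (\<forall>a<N. (cmod (dft N q (int a)))\<^sup>2 = real N)"
    unfolding S_def by (subst sum_nonneg_eq_0_iff) auto
  also have "\<dots> \<longleftrightarrow> complex_hadamard N (circ_of N q)"
    using complex_hadamard_circ_of_iff[OF N assms(3)] by simp
  finally have equality: "Phi N q = (of_nat N)\<^sup>2 \<longleftrightarrow> complex_hadamard N (circ_of N q)" .
  moreover have "complex_hadamard N (circ_of N q) \<longleftrightarrow>
    (\<exists>H. circulant N H \<and> complex_hadamard N H \<and>
      eigenvalue_vector N H (complex_of_real (sqrt (real N)) \<cdot>\<^sub>v q))"
    \<comment> \<open>The only possible \<open>H\<close> is \<open>circ_of N q\<close>, which is
      indeed circulant.\<close>
    using eigenvalue_vector_circ_of_iff[OF _ assms(2)] circulant_circ_of[OF N] circ_of_carrier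
    unfolding circulant_def by metis
  moreover have "Phi N q \<in> \<real>" "Re (Phi N q) \<ge> (real N)\<^sup>2"
    using S0 by (simp_all only: Phi Reals_of_real Re_complex_of_real) simp
  ultimately show ?thesis by blast
qed

end
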